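(* There exist absolute constants $c>0$ and $C$, and a function $\varepsilon(N)$ with $\varepsilon(N)\to0$ as $N\to\infty$, such that for all sufficiently large primes $N$ there is a subset $A\subset\mathbb{Z}_N$ with $\bigl||A|/N-\tfrac12\bigr|\leqslant\varepsilon(N)$ (i.e. of density $\tfrac12+o(1)$) which is $CN^{-1/2}\log N$-uniform, and for which $$\mathbb{E}_{x,d}A(x)A(x+d)A(x+2d)A(x+3d)\leqslant 2^{-4}-c.$$
   Context: $\mathbb{Z}_N=\mathbb{Z}/N\mathbb{Z}$, $\omega=\exp(2\pi i/N)$, and $A(x)$ denotes the characteristic function of $A$. $\mathbb{E}_x$ denotes $N^{-1}\sum_{x\in\mathbb{Z}_N}$ and $\mathbb{E}_{x,d}$ denotes $N^{-2}\sum_{x,d\in\mathbb{Z}_N}$. For $f:\mathbb{Z}_N\to\mathbb{C}$ the Fourier transform is $\hat f(r)=\mathbb{E}_xf(x)\omega^{-rx}$. A set $A\subset\mathbb{Z}_N$ is called $\eta$-uniform if $|\hat A(r)|\leqslant\eta$ for every nonzero $r\in\mathbb{Z}_N$. *)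

theory Defs
  imports Complex_Main "HOL-Library.Indicator_Function" "HOL-Computational_Algebra.Primes"
begin

text \<open>
  The group of integers modulo \<open>N\<close> is represented by the canonical residues
  \<open>0, \<dots>, N - 1\<close>, with sums reduced modulo \<open>N\<close>; in particular
  the nonzero residues are \<open>1, \<dots>, N - 1\<close>.
\<close>

definition Zmod :: "nat \<Rightarrow> int set" where
  "Zmod N = {0..<int N}"

definition omega :: "nat \<Rightarrow> complex" where
  "omega N = exp (2 * of_real pi * \<i> / of_nat N)"

definition expect :: "nat \<Rightarrow> (int \<Rightarrow> 'a::real_field) \<Rightarrow> 'a" where
  "expect N f = inverse (of_nat N) * (\<Sum>x\<in>Zmod N. f x)"

definition expect2 :: "nat \<Rightarrow> (int \<Rightarrow> int \<Rightarrow> 'a::real_field) \<Rightarrow> 'a" where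
  "expect2 N f = inverse (of_nat N ^ 2) * (\<Sum>x\<in>Zmod N. \<Sum>d\<in>Zmod N. f x d)"

definition fourier :: "nat \<Rightarrow> (int \<Rightarrow> complex) \<Rightarrow> int \<Rightarrow> complex" where
  "fourier N f r = expect N (\<lambda>x. f x * omega N powi (- (r * x)))"

definition uniform_set :: "nat \<Rightarrow> real \<Rightarrow> int set \<Rightarrow> bool" where
  "uniform_set N \<eta> A \<longleftrightarrow>
     A \<subseteq> Zmod N \<and> (\<forall>r\<in>Zmod N. r \<noteq> 0 \<longrightarrow> cmod (fourier N (indicator A) r) \<le> \<eta>)"

definition ap4_density :: "nat \<Rightarrow> int set \<Rightarrow> real" where
  "ap4_density N A =
     expect2 N (\<lambda>x d. indicator A x
                      * indicator A ((x + d) mod int N)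
                      * indicator A ((x + 2 * d) mod int N)
                      * indicator A ((x + 3 * d) mod int N))"

end

theory Submission
  imports Defs
begin

text \<open>
  Start from a weight function \<open>g\<close> on the residues with values in \<open>[0, 1]\<close>: one half plus a small
  combination of cosines of the quadratic phases \<open>x\<^sup>2\<close>, \<open>x\<^sup>2 + x\<close>, \<open>3x\<^sup>2 + x\<close>, \<open>3x\<^sup>2 + 2x\<close> (times
  \<open>2\<pi>/N\<close>), the last one with a negative sign. Gauss sums make all nontrivial Fourier
  coefficients of \<open>g\<close> of size \<open>O(N\<^sup>-\<^sup>1\<^sup>/\<^sup>2)\<close>. In the expansion of the weighted count of
  four-term progressions, all products of phases average to \<open>O(N\<^sup>-\<^sup>1\<^sup>/\<^sup>2)\<close> except those that
  cancel identically, and these contribute \<open>1/16 - 4/16\<^sup>4\<close>.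

  The function \<open>g\<close> is rounded to a set by the method of conditional expectations: a functional
  that is affine in each coordinate takes at some vertex of the cube a value at most its value
  at \<open>g\<close>. Applied to the progression density plus \<open>N\<^sup>-\<^sup>2\<close> times the exponential moments of all
  Fourier coefficients of the rounding error, on the scale \<open>N\<^sup>1\<^sup>/\<^sup>2\<close>, this bounds each moment by
  \<open>N\<^sup>2\<close>, hence each coefficient by \<open>O(N\<^sup>-\<^sup>1\<^sup>/\<^sup>2 log N)\<close>.
\<close>

subsection \<open>Quadratic exponential sums\<close>

definition ephase :: "nat \<Rightarrow> int \<Rightarrow> complex" where
  "ephase N k = cis (2 * pi * of_int k / of_nat N)"

lemma ephase_0 [simp]: "ephase N 0 = 1"
  by (simp add: ephase_def)

lemma norm_ephase [simp]: "cmod (ephase N k) = 1"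
  by (simp add: ephase_def)

lemma ephase_add: "ephase N (j + k) = ephase N j * ephase N k"
  by (simp add: ephase_def cis_mult add_divide_distrib distrib_left)

lemma ephase_minus: "ephase N (- k) = cnj (ephase N k)"
  by (simp add: ephase_def cis_cnj)

lemma omega_powi: "omega N powi k = ephase N k"
proof -
  have "omega N = cis (2 * pi / of_nat N)"
    by (simp add: omega_def cis_conv_exp mult_ac)
  thus ?thesis by (simp add: ephase_def cis_power_int mult_ac)
qed

lemma ephase_eq_1_iff:
  assumes "N > 0"
  shows "ephase N k = 1 \<longleftrightarrow> int N dvd k"
proof -
  have "ephase N k = 1 \<longleftrightarrow> (\<exists>m. 2 * pi * of_int k / of_nat N = of_int m * 2 * pi)"
    unfolding cos_one_2pi_int[symmetric]
    by (auto simp: ephase_def complex_eq_iff cos_one_sin_zero)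
  also have "\<dots> \<longleftrightarrow> (\<exists>m. real_of_int k = real_of_int (int N * m))"
    using assms by (simp add: field_simps)
  also have "\<dots> \<longleftrightarrow> int N dvd k"
    unfolding of_int_eq_iff dvd_def ..
  finally show ?thesis .
qed

lemma ephase_eqI:
  assumes "N > 0" "int N dvd j - k"
  shows "ephase N j = ephase N k"
proof -
  have "ephase N j = ephase N (j - k) * ephase N k"
    by (simp flip: ephase_add)
  thus ?thesis using assms by (simp add: ephase_eq_1_iff)
qed

section \<open>Residues modulo \<open>N\<close> and complete exponential sums\<close>

lemma finite_Zmod [simp]: "finite (Zmod N)"
  by (simp add: Zmod_def)

lemma card_Zmod [simp]: "card (Zmod N) = N"
  by (simp add: Zmod_def)

lemma mod_in_Zmod [simp]: "N > 0 \<Longrightarrow> k mod int N \<in> Zmod N"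
  by (simp add: Zmod_def)

lemma Zmod_eqI:
  assumes "x \<in> Zmod N" "y \<in> Zmod N" "int N dvd x - y"
  shows "x = y"
  using assms unfolding Zmod_def
  by (metis atLeastLessThan_iff mod_eq_dvd_iff mod_pos_pos_trivial)

lemma sum_Zmod_shift:
  assumes "N > 0" and per: "\<And>x. F (x mod int N) = F x"
  shows "(\<Sum>x\<in>Zmod N. F (x + h)) = (\<Sum>x\<in>Zmod N. F x)"
proof -
  have inj: "inj_on (\<lambda>x. (x + h) mod int N) (Zmod N)"
    by (rule inj_onI) (auto intro!: Zmod_eqI simp: mod_eq_dvd_iff)
  have "(\<lambda>x. (x + h) mod int N) ` Zmod N = Zmod N"
    using assms(1) by (intro card_subset_eq) (auto simp: card_image[OF inj])
  hence "bij_betw (\<lambda>x. (x + h) mod int N) (Zmod N) (Zmod N)"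
    using inj by (simp add: bij_betw_def)
  from sum.reindex_bij_betw[OF this, of F] show ?thesis
    by (simp add: per)
qed

text \<open>Shifting the variable by 1 multiplies the sum by \<open>ephase N r\<close>, which
  differs from 1 unless \<open>N\<close> divides \<open>r\<close>; so the sum must vanish.\<close>

lemma sum_ephase_linear:
  assumes "N > 0"
  shows "(\<Sum>x\<in>Zmod N. ephase N (r * x)) = (if int N dvd r then of_nat N else 0)"
proof (cases "int N dvd r")
  case True
  hence "ephase N (r * x) = 1" for x
    using assms by (simp add: ephase_eq_1_iff)
  thus ?thesis using True by simp
next
  case False
  let ?S = "\<Sum>x\<in>Zmod N. ephase N (r * x)"
  have "?S = (\<Sum>x\<in>Zmod N. ephase N (r * (x + 1)))"
    using assms 
    by (intro sum_Zmod_shift[symmetric] ephase_eqI)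
       (auto simp flip: right_diff_distrib intro!: dvd_mult simp: mod_eq_dvd_iff[symmetric])
  also have "\<dots> = ephase N r * ?S"
    by (simp add: distrib_left ephase_add sum_distrib_left mult_ac)
  finally have "?S = 0"
    using False assms ephase_eq_1_iff[of N r] by auto
  thus ?thesis using False by simp
qed

lemma dvd_poly_mod:
  "int N dvd (a * (x mod int N)\<^sup>2 + b * (x mod int N)) - (a * x\<^sup>2 + b * x)"
proof -
  have "(a * (x mod int N)\<^sup>2 + b * (x mod int N)) - (a * x\<^sup>2 + b * x)
     = (x mod int N - x) * (a * (x mod int N + x) + b)"
    by (simp add: algebra_simps power2_eq_square)
  moreover have "int N dvd x mod int N - x"
    by (simp flip: mod_eq_dvd_iff)
  ultimately show ?thesis by simp
qed

lemma ephase_quadratic_mod: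
  assumes "N > 0"
  shows "ephase N (a * (x mod int N)\<^sup>2 + b * (x mod int N)) = ephase N (a * x\<^sup>2 + b * x)"
  using assms dvd_poly_mod by (rule ephase_eqI)

text \<open>Expand the squared modulus and substitute \<open>y = h + x\<close>: the terms quadratic
  in \<open>x\<close> cancel, leaving a linear sum in \<open>x\<close> that vanishes unless
  \<open>N\<close> divides \<open>2 * a * h\<close>. As \<open>2 * a\<close> is invertible modulo
  \<open>N\<close>, only \<open>h = 0\<close> survives.\<close>

lemma gauss_sum:
  assumes "prime N" "N > 2" and a: "\<not> int N dvd a"
  shows "cmod (\<Sum>x\<in>Zmod N. ephase N (a * x\<^sup>2 + b * x)) = sqrt (real N)"
proof -
  let ?e = "ephase N" and ?q = "\<lambda>x. a * x\<^sup>2 + b * x"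
  let ?S = "\<Sum>x\<in>Zmod N. ?e (?q x)"
  have N: "N > 0" using assms by simp
  have dvd: "int N dvd 2 * a * h \<longleftrightarrow> h = 0" if "h \<in> Zmod N" for h
  proof -
    have "\<not> int N dvd 2" using \<open>N > 2\<close> by (auto dest: zdvd_imp_le)
    hence "int N dvd 2 * a * h \<longleftrightarrow> int N dvd h"
      using a \<open>prime N\<close> by (simp add: prime_dvd_mult_iff)
    also have "\<dots> \<longleftrightarrow> h = 0"
      using that N Zmod_eqI[of h N 0] by (auto simp: Zmod_def)
    finally show ?thesis .
  qed
  have "?S * cnj ?S = (\<Sum>x\<in>Zmod N. ?e (- ?q x) * (\<Sum>y\<in>Zmod N. ?e (?q y)))"
    by (simp add: sum_distrib_right sum_distrib_left ephase_minus mult.commute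
             del: minus_add_distrib)
  also have "\<dots> = (\<Sum>x\<in>Zmod N. ?e (- ?q x) * (\<Sum>h\<in>Zmod N. ?e (?q (h + x))))"
    by (subst sum_Zmod_shift[where F = "\<lambda>y. ?e (?q y)"])
       (use N in \<open>simp_all add: ephase_quadratic_mod\<close>)
  also have "\<dots> = (\<Sum>x\<in>Zmod N. \<Sum>h\<in>Zmod N. ?e (?q h) * ?e (2 * a * h * x))"
    by (simp add: sum_distrib_left algebra_simps power2_eq_square flip: ephase_add)
  also have "\<dots> = (\<Sum>h\<in>Zmod N. ?e (?q h) * (\<Sum>x\<in>Zmod N. ?e (2 * a * h * x)))"
    by (subst sum.swap) (simp add: sum_distrib_left)
  also have "\<dots> = (\<Sum>h\<in>Zmod N. if h = 0 then of_nat N else 0)"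
    by (intro sum.cong) (auto simp: sum_ephase_linear[OF N] dvd)
  also have "\<dots> = of_nat N"
    using N by (simp add: Zmod_def)
  finally have "(cmod ?S)\<^sup>2 = real N"
    unfolding complex_norm_square[symmetric] by (metis of_real_eq_iff of_real_of_nat_eq)
  thus ?thesis by (simp add: real_sqrt_unique)
qed

text \<open>If \<open>a\<close> or \<open>c\<close> is nonzero modulo \<open>N\<close>, each inner
  sum over that variable is a Gauss sum. Otherwise the sum over \<open>y\<close> is linear: for
  \<open>b\<close> nonzero it survives for at most one \<open>x\<close>; for \<open>b\<close> zero
  the double sum factors into two linear sums, one of which vanishes.\<close>

lemma norm_quadratic_sum2_le:
  assumes "prime N" "N > 2"
    and nz: "\<not> (int N dvd a \<and> int N dvd b \<and> int N dvd c \<and> int N dvd u \<and> int N dvd v)"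
  shows "cmod (\<Sum>x\<in>Zmod N. \<Sum>y\<in>Zmod N. ephase N (a * x\<^sup>2 + b * x * y + c * y\<^sup>2 + u * x + v * y))
           \<le> real N * sqrt (real N)"
proof -
  let ?e = "ephase N" and ?Z = "Zmod N"
  let ?Q = "\<lambda>x y. a * x\<^sup>2 + b * x * y + c * y\<^sup>2 + u * x + v * y"
  let ?T = "\<Sum>x\<in>?Z. \<Sum>y\<in>?Z. ?e (?Q x y)"
  have N: "N > 0" using assms by simp
  have T1: "?T = (\<Sum>x\<in>?Z. ?e (a * x\<^sup>2 + u * x) * (\<Sum>y\<in>?Z. ?e (c * y\<^sup>2 + (b * x + v) * y)))"
    by (simp add: sum_distrib_left algebra_simps flip: ephase_add)
  have T2: "?T = (\<Sum>y\<in>?Z. ?e (c * y\<^sup>2 + v * y) * (\<Sum>x\<in>?Z. ?e (a * x\<^sup>2 + (b * y + u) * x)))"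
    by (subst sum.swap) (simp add: sum_distrib_left algebra_simps flip: ephase_add)
  show ?thesis
  proof (cases "int N dvd c")
    case False
    have "cmod ?T \<le> (\<Sum>x\<in>?Z. sqrt (real N))"
      unfolding T1 using gauss_sum[OF assms(1,2) False]
      by (intro sum_norm_le) (simp add: norm_mult)
    thus ?thesis by simp
  next
    case c: True
    show ?thesis
    proof (cases "int N dvd a")
      case False
      have "cmod ?T \<le> (\<Sum>x\<in>?Z. sqrt (real N))"
        unfolding T2 using gauss_sum[OF assms(1,2) False]
        by (intro sum_norm_le) (simp add: norm_mult)
      thus ?thesis by simp
    next
      case a: True
      have inner: "(\<Sum>y\<in>?Z. ?e (c * y\<^sup>2 + w * y)) = (if int N dvd w then of_nat N else 0)" for w
      proof -
        have "?e (c * y\<^sup>2 + w * y) = ?e (w * y)" for y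
          using c N by (intro ephase_eqI) auto
        thus ?thesis by (simp add: sum_ephase_linear[OF N])
      qed
      show ?thesis
      proof (cases "int N dvd b")
        case False
        have *: "x = y" if "x \<in> ?Z" "y \<in> ?Z" "int N dvd b * x + v" "int N dvd b * y + v" for x y
        proof -
          have "int N dvd b * (x - y)"
            using dvd_diff[OF that(3,4)] by (simp add: algebra_simps)
          hence "int N dvd x - y"
            using False \<open>prime N\<close> by (simp add: prime_dvd_mult_iff)
          thus ?thesis using that by (auto intro: Zmod_eqI)
        qed
        let ?B = "{x\<in>?Z. int N dvd b * x + v}"
        have "card ?B \<le> 1"
          using * by (subst card_le_Suc0_iff_eq[unfolded One_nat_def[symmetric]]) auto
        have "cmod ?T \<le> (\<Sum>x\<in>?Z. if int N dvd b * x + v then real N else 0)"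
          unfolding T1 inner by (intro sum_norm_le) (simp add: norm_mult)
        also have "\<dots> = real (card ?B) * real N"
          by (simp add: sum.If_cases Int_def)
        also have "\<dots> \<le> 1 * real N"
          using \<open>card ?B \<le> 1\<close> by (intro mult_right_mono) auto
        also have "\<dots> \<le> real N * sqrt (real N)"
          using N by (simp add: mult_le_cancel_left1)
        finally show ?thesis .
      next
        case b: True
        have dv: "int N dvd b * x + v \<longleftrightarrow> int N dvd v" for x
          using b by (simp add: dvd_add_right_iff)
        have "?T = (\<Sum>x\<in>?Z. ?e (u * x) * (if int N dvd v then of_nat N else 0))"
          unfolding T1 inner dv
        proof (intro sum.cong refl arg_cong2[where f = "(*)"])
          show "?e (a * x\<^sup>2 + u * x) = ?e (u * x)" for x
            using a N by (intro ephase_eqI) auto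
        qed
        also have "\<dots> = 0"
          unfolding sum_distrib_right[symmetric] sum_ephase_linear[OF N]
          using nz a b c by auto
        finally show ?thesis by simp
      qed
    qed
  qed
qed

subsection \<open>Rounding by multiaffine functionals\<close>

text \<open>Interpolating between 0 and 1 is averaging over a coordinate that is 1 with probability
  \<open>t\<close>.\<close>

definition multiaffine :: "'a set \<Rightarrow> (('a \<Rightarrow> real) \<Rightarrow> real) \<Rightarrow> bool" where
  "multiaffine X \<Phi> \<longleftrightarrow>
     (\<forall>x\<in>X. \<forall>h t. \<Phi> (h(x := t)) = (1 - t) * \<Phi> (h(x := 0)) + t * \<Phi> (h(x := 1)))"

lemma multiaffine_apply: "multiaffine X (\<lambda>h. h i)"
  by (auto simp: multiaffine_def algebra_simps)

lemma multiaffine_add: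
  assumes "multiaffine X \<Phi>" "multiaffine X \<Psi>"
  shows "multiaffine X (\<lambda>h. \<Phi> h + \<Psi> h)"
  unfolding multiaffine_def
proof (intro ballI allI)
  fix x h and t :: real
  assume "x \<in> X"
  hence "\<Phi> (h(x := t)) = (1 - t) * \<Phi> (h(x := 0)) + t * \<Phi> (h(x := 1))"
    "\<Psi> (h(x := t)) = (1 - t) * \<Psi> (h(x := 0)) + t * \<Psi> (h(x := 1))"
    using assms unfolding multiaffine_def by blast+
  thus "\<Phi> (h(x := t)) + \<Psi> (h(x := t)) =
    (1 - t) * (\<Phi> (h(x := 0)) + \<Psi> (h(x := 0))) + t * (\<Phi> (h(x := 1)) + \<Psi> (h(x := 1)))"
    by (simp only:) (simp add: algebra_simps)
qed

lemma multiaffine_cmult: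
  assumes "multiaffine X \<Phi>"
  shows "multiaffine X (\<lambda>h. c * \<Phi> h)"
  unfolding multiaffine_def
proof (intro ballI allI)
  fix x h and t :: real
  assume "x \<in> X"
  hence "\<Phi> (h(x := t)) = (1 - t) * \<Phi> (h(x := 0)) + t * \<Phi> (h(x := 1))"
    using assms unfolding multiaffine_def by blast
  thus "c * \<Phi> (h(x := t)) = (1 - t) * (c * \<Phi> (h(x := 0))) + t * (c * \<Phi> (h(x := 1)))"
    by (simp only:) (simp add: algebra_simps)
qed

lemma multiaffine_sum:
  assumes "\<And>i. i \<in> I \<Longrightarrow> multiaffine X (\<Phi> i)"
  shows "multiaffine X (\<lambda>h. \<Sum>i\<in>I. \<Phi> i h)"
  using assms
proof (induction I rule: infinite_finite_induct)
  case (insert i I)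
  thus ?case by (simp add: multiaffine_add)
qed (simp_all add: multiaffine_def)

text \<open>Each coordinate enters at most one factor, and affinely; \<open>p i\<close> and
  \<open>q i\<close> are the values of that factor at 1 and 0.\<close>

lemma multiaffine_prod:
  assumes "finite I"
  shows "multiaffine X (\<lambda>h. \<Prod>i\<in>I. h i * p i + (1 - h i) * q i)"
  unfolding multiaffine_def
proof (intro ballI allI)
  fix x h and t :: real
  let ?P = "\<lambda>t. \<Prod>i\<in>I. (h(x := t)) i * p i + (1 - (h(x := t)) i) * q i"
  show "?P t = (1 - t) * ?P 0 + t * ?P 1"
  proof (cases "x \<in> I")
    case True
    have "?P t = (t * p x + (1 - t) * q x) * (\<Prod>i\<in>I-{x}. h i * p i + (1 - h i) * q i)" for t
      using True assms by (simp add: prod.remove)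
    thus ?thesis by (simp only:) (simp add: algebra_simps)
  next
    case False
    hence "?P t = (\<Prod>i\<in>I. h i * p i + (1 - h i) * q i)" for t
      by (intro prod.cong) auto
    thus ?thesis by (simp only:) (simp add: algebra_simps)
  qed
qed

text \<open>A repeated index would create a square, which is not affine; hence the
  distinctness.\<close>

lemma multiaffine_mult4:
  assumes "distinct [i, j, k, l]"
  shows "multiaffine X (\<lambda>h. h i * h j * h k * h l)"
  using multiaffine_prod[of "{i, j, k, l}" X "\<lambda>_. 1" "\<lambda>_. 0"] assms
  by (simp add: mult.assoc)

text \<open>The deterministic form of random rounding: choosing each \<open>x\<close> independently with
  probability \<open>g x\<close>, the expectation of a multiaffine functional is its value at \<open>g\<close>.\<close>

lemma multiaffine_rounding:
  assumes "finite X" "multiaffine X \<Phi>" "\<And>x. x \<in> X \<Longrightarrow> 0 \<le> g x \<and> g x \<le> 1"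
  obtains A where "A \<subseteq> X" "\<Phi> (\<lambda>x. if x \<in> X then indicator A x else g x) \<le> \<Phi> g"
proof -
  have "\<exists>A\<subseteq>X. \<Phi> (\<lambda>x. if x \<in> X then indicator A x else g x) \<le> \<Phi> g"
    using assms
  proof (induction X rule: finite_induct)
    case (insert y X)
    have "multiaffine X \<Phi>" using insert.prems(1) unfolding multiaffine_def by blast
    then obtain A where A: "A \<subseteq> X" "\<Phi> (\<lambda>x. if x \<in> X then indicator A x else g x) \<le> \<Phi> g"
      using insert.IH insert.prems(2) by blast
    define h :: "'a \<Rightarrow> real" where "h = (\<lambda>x. if x \<in> X then indicator A x else g x)"
    have "\<Phi> (h(y := g y)) = (1 - g y) * \<Phi> (h(y := 0)) + g y * \<Phi> (h(y := 1))"
      using insert.prems(1) unfolding multiaffine_def by blast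
    moreover have "h(y := g y) = h" using insert.hyps by (auto simp: h_def)
    ultimately have eq: "\<Phi> h = (1 - g y) * \<Phi> (h(y := 0)) + g y * \<Phi> (h(y := 1))" by simp
    have Ah: "\<Phi> h \<le> \<Phi> g" using A(2) by (simp only: h_def)
    have g: "0 \<le> g y" "g y \<le> 1" using insert.prems(2) by auto
    \<comment> \<open>A convex combination of the two endpoint values cannot lie below both.\<close>
    have "\<Phi> (h(y := 0)) \<le> \<Phi> h \<or> \<Phi> (h(y := 1)) \<le> \<Phi> h"
    proof (rule ccontr)
      let ?m = "min (\<Phi> (h(y := 0))) (\<Phi> (h(y := 1)))"
      assume "\<not> ?thesis"
      hence "\<Phi> h < ?m" by simp
      also have "?m = (1 - g y) * ?m + g y * ?m" by (simp add: algebra_simps)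
      also have "\<dots> \<le> \<Phi> h"
        unfolding eq using g by (intro add_mono mult_left_mono) auto
      finally show False by simp
    qed
    thus ?case
    proof
      assume "\<Phi> (h(y := 0)) \<le> \<Phi> h"
      moreover have "h(y := 0) = (\<lambda>x. if x \<in> insert y X then indicator A x else g x)"
        using A insert.hyps by (auto simp: h_def fun_eq_iff indicator_def)
      ultimately show ?case using A(1) Ah by (intro exI[of _ A]) auto
    next
      assume "\<Phi> (h(y := 1)) \<le> \<Phi> h"
      moreover have "h(y := 1) = (\<lambda>x. if x \<in> insert y X then indicator (insert y A) x else g x)"
        by (auto simp: h_def fun_eq_iff indicator_def)
      ultimately show ?case using A(1) Ah by (intro exI[of _ "insert y A"]) auto
    qed
  qed auto
  thus ?thesis using that by blast
qed

section \<open>Exponential moments of the rounding error\<close>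

text \<open>For negative \<open>y = - z\<close>, multiply \<open>1 + z \<le> exp z\<close> by
  \<open>1 - z + z\<^sup>2\<close>; the left side becomes \<open>1 + z ^ 3\<close>, which exceeds
  1.\<close>

lemma exp_le_quadratic:
  fixes y :: real
  assumes "\<bar>y\<bar> \<le> 1"
  shows "exp y \<le> 1 + y + y\<^sup>2"
proof (cases "0 \<le> y")
  case True
  thus ?thesis using assms exp_bound[of y] by simp
next
  case False
  define z where "z = - y"
  have z: "0 < z" using False by (simp add: z_def)
  have "1 \<le> (1 + z) * (1 - z + z\<^sup>2)"
  proof -
    have "(1 + z) * (1 - z + z\<^sup>2) = 1 + z ^ 3"
      by (simp add: algebra_simps power2_eq_square power3_eq_cube)
    thus ?thesis using z by simp
  qed
  also have "\<dots> \<le> exp z * (1 - z + z\<^sup>2)"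
  proof (intro mult_right_mono)
    have "1 - z + z\<^sup>2 = (1 - z / 2)\<^sup>2 + 3 / 4 * z\<^sup>2"
      by (simp add: power2_eq_square algebra_simps)
    also have "\<dots> \<ge> 0" by simp
    finally show "0 \<le> 1 - z + z\<^sup>2" .
  qed simp
  finally have "exp y * 1 \<le> exp y * (exp z * (1 - z + z\<^sup>2))"
    by (intro mult_left_mono) auto
  also have "\<dots> = exp (y + z) * (1 - z + z\<^sup>2)"
    by (simp add: exp_add)
  finally show ?thesis by (simp add: z_def)
qed

text \<open>A coordinate that is 1 with probability \<open>g\<close> deviates from \<open>g\<close>
  with mean 0, so the linear terms cancel and \<open>1 + s\<^sup>2\<close> remains, as in
  Hoeffding's bound.\<close>

lemma rounding_factor_bound:
  fixes g s t :: real
  assumes "0 \<le> g" "g \<le> 1" "0 \<le> s" "s \<le> 1" "\<bar>t\<bar> \<le> 1"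
  shows "g * exp (s * ((1 - g) * t)) + (1 - g) * exp (s * ((0 - g) * t)) \<le> exp (s\<^sup>2)"
proof -
  have bnd: "\<bar>s * (v * t)\<bar> \<le> s" if "\<bar>v\<bar> \<le> 1" for v
  proof -
    have "\<bar>v * t\<bar> \<le> 1"
      using that assms unfolding abs_mult by (intro mult_le_one) auto
    thus ?thesis using assms by (simp add: abs_mult mult_left_le)
  qed
  have e: "exp (s * (v * t)) \<le> 1 + s * (v * t) + s\<^sup>2" if "\<bar>v\<bar> \<le> 1" for v
  proof -
    have "exp (s * (v * t)) \<le> 1 + s * (v * t) + (s * (v * t))\<^sup>2"
      using bnd[OF that] assms by (intro exp_le_quadratic) linarith
    also have "(s * (v * t))\<^sup>2 \<le> s\<^sup>2"
      using bnd[OF that] assms by (intro abs_le_square_iff[THEN iffD1]) auto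
    finally show ?thesis by simp
  qed
  have "g * exp (s * ((1 - g) * t)) + (1 - g) * exp (s * ((0 - g) * t)) \<le>
      g * (1 + s * ((1 - g) * t) + s\<^sup>2) + (1 - g) * (1 + s * ((0 - g) * t) + s\<^sup>2)"
    using assms by (intro add_mono mult_left_mono e) auto
  also have "\<dots> = 1 + s\<^sup>2" by (simp add: algebra_simps)
  also have "\<dots> \<le> exp (s\<^sup>2)" by simp
  finally show ?thesis .
qed

text \<open>Chernoff's method without probability: one vertex has to serve the objective and all
  tests at once, so the exponential moments join \<open>\<Psi>\<close> as a penalty of weight
  \<open>W\<close>.\<close>

lemma rounding_with_tests:
  fixes t :: "'i \<Rightarrow> 'a \<Rightarrow> real"
  assumes "finite X" "multiaffine X \<Psi>" and g: "\<And>x. x \<in> X \<Longrightarrow> 0 \<le> g x \<and> g x \<le> 1"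
    and t: "\<And>i x. i \<in> I \<Longrightarrow> x \<in> X \<Longrightarrow> \<bar>t i x\<bar> \<le> 1" and s: "0 \<le> s" "s \<le> 1" and W: "0 \<le> W"
  obtains A h where "A \<subseteq> X" "\<And>x. x \<in> X \<Longrightarrow> h x = indicator A x"
    "\<Psi> h + W * (\<Sum>i\<in>I. exp (s * (\<Sum>x\<in>X. (indicator A x - g x) * t i x)))
       \<le> \<Psi> g + W * (real (card I) * exp (s\<^sup>2 * real (card X)))"
proof -
  \<comment> \<open>The multiaffine extension of an exponential moment: at a vertex the exponential
    of the tested rounding error, at \<open>g\<close> its mean under independent rounding, which
    factors over \<open>x\<close>.\<close>
  define P where "P = (\<lambda>i a. \<Prod>x\<in>X. a x * exp (s * ((1 - g x) * t i x))
                           + (1 - a x) * exp (s * ((0 - g x) * t i x)))"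
  define \<Phi> where "\<Phi> = (\<lambda>a. \<Psi> a + W * (\<Sum>i\<in>I. P i a))"
  have "multiaffine X \<Phi>"
    unfolding \<Phi>_def P_def using assms(1,2)
    by (intro multiaffine_add multiaffine_cmult multiaffine_sum multiaffine_prod)
  then obtain A where A: "A \<subseteq> X" "\<Phi> (\<lambda>x. if x \<in> X then indicator A x else g x) \<le> \<Phi> g"
    using multiaffine_rounding[of X \<Phi> g] assms(1) g by blast
  define h :: "'a \<Rightarrow> real" where "h = (\<lambda>x. if x \<in> X then indicator A x else g x)"
  have "P i h = exp (s * (\<Sum>x\<in>X. (indicator A x - g x) * t i x))" for i
    unfolding P_def sum_distrib_left exp_sum[OF \<open>finite X\<close>]
    by (intro prod.cong) (auto simp: h_def indicator_def)
  hence \<Phi>h: "\<Phi> h = \<Psi> h + W * (\<Sum>i\<in>I. exp (s * (\<Sum>x\<in>X. (indicator A x - g x) * t i x)))"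
    by (simp add: \<Phi>_def)
  have "P i g \<le> exp (s\<^sup>2 * real (card X))" if "i \<in> I" for i
  proof -
    have "P i g \<le> (\<Prod>x\<in>X. exp (s\<^sup>2))"
      unfolding P_def using that g t s
      by (intro prod_mono conjI rounding_factor_bound) auto
    also have "\<dots> = exp (s\<^sup>2 * real (card X))"
      by (simp add: mult.commute flip: exp_of_nat_mult)
    finally show ?thesis .
  qed
  hence "(\<Sum>i\<in>I. P i g) \<le> real (card I) * exp (s\<^sup>2 * real (card X))"
    by (rule sum_bounded_above)
  hence "\<Phi> g \<le> \<Psi> g + W * (real (card I) * exp (s\<^sup>2 * real (card X)))"
    unfolding \<Phi>_def using W by (intro add_left_mono mult_left_mono)
  with A(2) \<Phi>h show ?thesis
    by (intro that[of A h] A(1)) (auto simp: h_def)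
qed

subsection \<open>The weight function\<close>

text \<open>A pair \<open>(k, l)\<close> stands for the phase \<open>k * x\<^sup>2 + l * x\<close>;
  negatives are included to form cosines.\<close>

definition quad_freqs :: "(int \<times> int) set" where
  "quad_freqs = {(0, 0), (1, 0), (-1, 0), (1, 1), (-1, -1), (3, 1), (-3, -1), (3, 2), (-3, -2)}"

text \<open>A cosine of coefficient 1/8 splits into two conjugate phases of coefficient
  1/16.\<close>

definition quad_coeff :: "int \<times> int \<Rightarrow> real" where
  "quad_coeff p =
     (if p = (0, 0) then 1 / 2 else if p \<in> {(3, 2), (-3, -2)} then - 1 / 16 else 1 / 16)"

text \<open>The only nontrivial relation among the squares along a progression is
  \<open>x\<^sup>2 - 3 (x + d)\<^sup>2 + 3 (x + 2d)\<^sup>2 - (x + 3d)\<^sup>2 = 0\<close>. The linear parts are chosen such that the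
  only quadruples of phases cancelling along it are
  \<open>x\<^sup>2, - (3x\<^sup>2 + x), 3x\<^sup>2 + 2x, - (x\<^sup>2 + x)\<close>, its reversal, and their negatives, so that
  the phase \<open>3x\<^sup>2 + 2x\<close> occurs once in each and its negative coefficient decides the sign.
  (Without linear parts the contribution of the fourfold products would be nonnegative.)\<close>

definition profile :: "nat \<Rightarrow> int \<Rightarrow> real" where
  "profile N x = 1 / 2 + (Re (ephase N (x\<^sup>2)) + Re (ephase N (x\<^sup>2 + x))
     + Re (ephase N (3 * x\<^sup>2 + x)) - Re (ephase N (3 * x\<^sup>2 + 2 * x))) / 8"

lemma finite_quad_freqs [simp]: "finite quad_freqs"
  by (simp add: quad_freqs_def)

text \<open>With total weight one, expanding a product of four weights does not amplify an error
  bound common to all terms.\<close>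

lemma sum_abs_quad_coeff: "(\<Sum>p\<in>quad_freqs. \<bar>quad_coeff p\<bar>) = 1"
  by (simp add: quad_freqs_def quad_coeff_def)

lemma profile_expansion:
  "of_real (profile N x) =
     (\<Sum>p\<in>quad_freqs. of_real (quad_coeff p) * ephase N (fst p * x\<^sup>2 + snd p * x))"
proof -
  have pair: "ephase N (- k) = of_real (2 * Re (ephase N k)) - ephase N k" for k
    by (simp add: ephase_minus complex_eq_iff)
  have neg: "- x\<^sup>2 - x = - (x\<^sup>2 + x)" "- (3 * x\<^sup>2) - x = - (3 * x\<^sup>2 + x)"
    "- (3 * x\<^sup>2) - 2 * x = - (3 * x\<^sup>2 + 2 * x)" by simp_all
  show ?thesis
    by (simp add: quad_freqs_def quad_coeff_def neg pair profile_def
             del: minus_add_distrib) (simp add: complex_eq_iff field_simps)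
qed

lemma profile_bounds: "0 \<le> profile N x" "profile N x \<le> 1"
proof -
  have "\<bar>Re (ephase N k)\<bar> \<le> 1" for k
    using abs_Re_le_cmod[of "ephase N k"] by simp
  from this[of "x\<^sup>2"] this[of "x\<^sup>2 + x"] this[of "3 * x\<^sup>2 + x"] this[of "3 * x\<^sup>2 + 2 * x"]
  show "0 \<le> profile N x" "profile N x \<le> 1"
    by (auto simp: profile_def abs_le_iff field_simps)
qed

lemma profile_mod:
  assumes "N > 0"
  shows "profile N (x mod int N) = profile N x"
  using ephase_quadratic_mod[OF assms, of 1 x 0] ephase_quadratic_mod[OF assms, of 1 x 1]
    ephase_quadratic_mod[OF assms, of 3 x 1] ephase_quadratic_mod[OF assms, of 3 x 2]
  by (simp add: profile_def)

text \<open>The Fourier twist alters only the linear part of each phase, so the eight nonconstant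
  phases give Gauss sums, each weighted by 1/16. \<open>N > 3\<close> keeps the leading coefficients
  1 and 3 invertible.\<close>

lemma profile_fourier:
  assumes "prime N" "N > 3"
  shows "cmod ((\<Sum>x\<in>Zmod N. of_real (profile N x) * ephase N (- (r * x)))
           - (if int N dvd r then of_nat N / 2 else 0)) \<le> sqrt (real N) / 2"
proof -
  let ?K = "quad_freqs - {(0, 0)}"
  define G where "G = (\<lambda>p. \<Sum>x\<in>Zmod N. ephase N (fst p * x\<^sup>2 + (snd p - r) * x))"
  have N: "N > 0" using assms by simp
  have "(\<Sum>x\<in>Zmod N. of_real (profile N x) * ephase N (- (r * x))) =
      (\<Sum>x\<in>Zmod N. \<Sum>p\<in>quad_freqs.
         of_real (quad_coeff p) * ephase N (fst p * x\<^sup>2 + (snd p - r) * x))"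
    unfolding profile_expansion sum_distrib_right mult.assoc ephase_add[symmetric]
    by (simp add: algebra_simps)
  also have "\<dots> = (\<Sum>p\<in>quad_freqs. of_real (quad_coeff p) * G p)"
    unfolding G_def by (subst sum.swap) (simp add: sum_distrib_left)
  also have "\<dots> = of_real (quad_coeff (0, 0)) * G (0, 0)
      + (\<Sum>p\<in>?K. of_real (quad_coeff p) * G p)"
    by (rule sum.remove) (auto simp: quad_freqs_def)
  also have "of_real (quad_coeff (0, 0)) * G (0, 0) = (if int N dvd r then of_nat N / 2 else 0)"
    using sum_ephase_linear[OF N, of "- r"] by (simp add: G_def quad_coeff_def)
  finally have eq: "(\<Sum>x\<in>Zmod N. of_real (profile N x) * ephase N (- (r * x)))
      - (if int N dvd r then of_nat N / 2 else 0) = (\<Sum>p\<in>?K. of_real (quad_coeff p) * G p)"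
    by simp
  have "cmod (\<Sum>p\<in>?K. of_real (quad_coeff p) * G p) \<le> (\<Sum>p\<in>?K. sqrt (real N) / 16)"
  proof (rule sum_norm_le)
    fix p assume p: "p \<in> ?K"
    hence "fst p \<in> {1, -1, 3, -3}" by (auto simp: quad_freqs_def)
    hence "fst p \<noteq> 0" "\<bar>fst p\<bar> \<le> 3" by auto
    hence "\<not> int N dvd fst p" using assms dvd_imp_le_int[of "fst p" "int N"] by auto
    hence "cmod (G p) = sqrt (real N)"
      unfolding G_def using assms by (intro gauss_sum) auto
    moreover have "\<bar>quad_coeff p\<bar> = 1 / 16" using p by (auto simp: quad_coeff_def)
    ultimately show "cmod (of_real (quad_coeff p) * G p) \<le> sqrt (real N) / 16"
      by (simp only: norm_mult norm_of_real)
  qed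
  also have "\<dots> = sqrt (real N) / 2"
    by (simp add: quad_freqs_def)
  finally show ?thesis unfolding eq .
qed

text \<open>The coefficients of \<open>\<Sum>i. k\<^sub>i (x + i d)\<^sup>2 + l\<^sub>i (x + i d)\<close> as a polynomial
  in \<open>x\<close> and \<open>d\<close>.\<close>

definition ap_vanishing :: "(int \<times> int) \<times> (int \<times> int) \<times> (int \<times> int) \<times> (int \<times> int) \<Rightarrow> bool" where
  "ap_vanishing = (\<lambda>((k0, l0), (k1, l1), (k2, l2), (k3, l3)).
     k0 + k1 + k2 + k3 = 0 \<and> 2 * (k1 + 2 * k2 + 3 * k3) = 0 \<and> k1 + 4 * k2 + 9 * k3 = 0 \<and>
     l0 + l1 + l2 + l3 = 0 \<and> l1 + 2 * l2 + 3 * l3 = 0)"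

text \<open>The quadratic equations force the pattern \<open>k0 * (1, -3, 3, -1)\<close>. Since
  \<open>k0\<close> and \<open>-3 * k0\<close> must both occur, \<open>k0\<close> is 0, 1 or -1; the
  linear equations then leave two choices for each sign.\<close>

lemma ap_vanishing_quad_freqs:
  "{\<kappa> \<in> quad_freqs \<times> quad_freqs \<times> quad_freqs \<times> quad_freqs. ap_vanishing \<kappa>} =
     {((0, 0), (0, 0), (0, 0), (0, 0)),
      ((1, 0), (-3, -1), (3, 2), (-1, -1)), ((-1, 0), (3, 1), (-3, -2), (1, 1)),
      ((1, 1), (-3, -2), (3, 1), (-1, 0)), ((-1, -1), (3, 2), (-3, -1), (1, 0))}"
  (is "?L = ?R")
proof
  \<comment> \<open>Unfolding \<open>quad_freqs_def\<close> below the products would enumerate all \<open>9\<^sup>4\<close> quadruples.\<close>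
  have mem_iff: "p \<in> quad_freqs \<longleftrightarrow> p \<in> {(0, 0), (1, 0), (-1, 0), (1, 1), (-1, -1), (3, 1),
      (-3, -1), (3, 2), (-3, -2)}" for p
    by (simp only: quad_freqs_def)
  show "?R \<subseteq> ?L" by (simp add: ap_vanishing_def mem_iff)
  show "?L \<subseteq> ?R"
  proof
    fix \<kappa> assume \<kappa>L: "\<kappa> \<in> ?L"
    obtain k0 l0 k1 l1 k2 l2 k3 l3 where \<kappa>: "\<kappa> = ((k0, l0), (k1, l1), (k2, l2), (k3, l3))"
      by (metis surj_pair)
    have mem: "(k0, l0) \<in> quad_freqs" "(k1, l1) \<in> quad_freqs"
        "(k2, l2) \<in> quad_freqs" "(k3, l3) \<in> quad_freqs"
      and van: "ap_vanishing \<kappa>"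
      using \<kappa>L by (simp_all add: \<kappa>)
    from van have eqs: "k0 + k1 + k2 + k3 = 0" "k1 + 2 * k2 + 3 * k3 = 0"
      "k1 + 4 * k2 + 9 * k3 = 0" "l0 + l1 + l2 + l3 = 0" "l1 + 2 * l2 + 3 * l3 = 0"
      by (simp_all add: \<kappa> ap_vanishing_def)
    have k1: "k1 = - 3 * k0" and k2: "k2 = 3 * k0" and k3: "k3 = - k0"
      using eqs(1-3) by linarith+
    have "k0 = 0 \<or> k0 = 1 \<or> k0 = - 1"
      using mem(1,2) unfolding k1 quad_freqs_def by auto
    then consider "k0 = 0" | "k0 = 1" | "k0 = - 1" by blast
    thus "\<kappa> \<in> ?R"
    proof cases
      case 1
      thus ?thesis using mem by (simp add: \<kappa> k1 k2 k3 quad_freqs_def)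
    next
      case 2
      hence "l0 = 0 \<or> l0 = 1" "l1 = - 1 \<or> l1 = - 2" "l2 = 1 \<or> l2 = 2" "l3 = 0 \<or> l3 = - 1"
        using mem by (simp_all add: k1 k2 k3 quad_freqs_def)
      thus ?thesis using eqs(4,5) 2 by (elim disjE) (simp_all add: \<kappa> k1 k2 k3)
    next
      case 3
      hence "l0 = 0 \<or> l0 = - 1" "l1 = 1 \<or> l1 = 2" "l2 = - 1 \<or> l2 = - 2" "l3 = 0 \<or> l3 = 1"
        using mem by (simp_all add: k1 k2 k3 quad_freqs_def)
      thus ?thesis using eqs(4,5) 3 by (elim disjE) (simp_all add: \<kappa> k1 k2 k3)
    qed
  qed
qed

lemma sum_mult4:
  fixes a b c e :: "'a \<Rightarrow> 'b::comm_semiring_0"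
  shows "sum a K * sum b K * sum c K * sum e K =
    (\<Sum>(p, q, r, s)\<in>K \<times> K \<times> K \<times> K. a p * b q * c r * e s)"
  by (simp add: mult.assoc flip: sum.cartesian_product sum_distrib_left sum_distrib_right)

text \<open>Expand into phases of quadratic forms in \<open>x\<close> and \<open>d\<close>.
  Identically vanishing forms contribute \<open>N\<^sup>2\<close> each, all others at most
  \<open>N * sqrt N\<close>.\<close>

lemma profile_ap4:
  assumes "prime N" "N > 50"
  shows "\<bar>(\<Sum>x\<in>Zmod N. \<Sum>d\<in>Zmod N.
             profile N x * profile N (x + d) * profile N (x + 2 * d) * profile N (x + 3 * d))
           - (real N)\<^sup>2 * (1 / 16 - 4 / 65536)\<bar> \<le> real N * sqrt (real N)"
proof -
  let ?K = "quad_freqs" and ?Z = "Zmod N"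
  let ?K4 = "?K \<times> ?K \<times> ?K \<times> ?K"
  define S where "S = (\<Sum>x\<in>?Z. \<Sum>d\<in>?Z.
    profile N x * profile N (x + d) * profile N (x + 2 * d) * profile N (x + 3 * d))"
  define w where "w = (\<lambda>(p, q, r, s). quad_coeff p * quad_coeff q * quad_coeff r * quad_coeff s)"
  define E where "E = (\<lambda>(p, q, r, s) x d.
    ephase N (fst p * x\<^sup>2 + snd p * x) * ephase N (fst q * (x + d)\<^sup>2 + snd q * (x + d)) *
    ephase N (fst r * (x + 2 * d)\<^sup>2 + snd r * (x + 2 * d)) *
    ephase N (fst s * (x + 3 * d)\<^sup>2 + snd s * (x + 3 * d)))"
  define T where "T = (\<lambda>\<kappa>. \<Sum>x\<in>?Z. \<Sum>d\<in>?Z. E \<kappa> x d)"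
  have expand: "complex_of_real (profile N x * profile N (x + d) * profile N (x + 2 * d) * profile N (x + 3 * d))
      = (\<Sum>\<kappa>\<in>?K4. of_real (w \<kappa>) * E \<kappa> x d)" for x d
    unfolding of_real_mult profile_expansion sum_mult4
    by (intro sum.cong) (auto simp: w_def E_def)
  have "complex_of_real S = (\<Sum>x\<in>?Z. \<Sum>d\<in>?Z. \<Sum>\<kappa>\<in>?K4. of_real (w \<kappa>) * E \<kappa> x d)"
    unfolding S_def of_real_sum expand ..
  also have "\<dots> = (\<Sum>\<kappa>\<in>?K4. \<Sum>x\<in>?Z. \<Sum>d\<in>?Z. of_real (w \<kappa>) * E \<kappa> x d)"
    by (subst sum.swap[of _ ?K4], subst sum.swap[of _ ?K4]) simp
  also have "\<dots> = (\<Sum>\<kappa>\<in>?K4. of_real (w \<kappa>) * T \<kappa>)"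
    by (simp add: T_def sum_distrib_left)
  finally have S: "complex_of_real S = (\<Sum>\<kappa>\<in>?K4. of_real (w \<kappa>) * T \<kappa>)" .

  define M where "M = (\<lambda>\<kappa>. if ap_vanishing \<kappa> then (real N)\<^sup>2 else 0)"
  have T: "cmod (T \<kappa> - of_real (M \<kappa>)) \<le> real N * sqrt (real N)" if "\<kappa> \<in> ?K4" for \<kappa>
  proof -
    obtain k0 l0 k1 l1 k2 l2 k3 l3 where \<kappa>: "\<kappa> = ((k0, l0), (k1, l1), (k2, l2), (k3, l3))"
      by (metis surj_pair)
    define a b c u v where "a = k0 + k1 + k2 + k3" and "b = 2 * (k1 + 2 * k2 + 3 * k3)"
      and "c = k1 + 4 * k2 + 9 * k3" and "u = l0 + l1 + l2 + l3" and "v = l1 + 2 * l2 + 3 * l3"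
    have E: "E \<kappa> x d = ephase N (a * x\<^sup>2 + b * x * d + c * d\<^sup>2 + u * x + v * d)" for x d
      unfolding E_def \<kappa> a_def b_def c_def u_def v_def
      by (simp add: algebra_simps power2_eq_square flip: ephase_add)
    have van: "ap_vanishing \<kappa> \<longleftrightarrow> a = 0 \<and> b = 0 \<and> c = 0 \<and> u = 0 \<and> v = 0"
      by (simp add: \<kappa> ap_vanishing_def a_def b_def c_def u_def v_def)
    show ?thesis
    proof (cases "ap_vanishing \<kappa>")
      case True
      hence "T \<kappa> = of_real (M \<kappa>)"
        using van unfolding T_def E by (simp add: M_def power2_eq_square)
      thus ?thesis by simp
    next
      case False
      have small: "\<bar>k\<bar> \<le> 3 \<and> \<bar>l\<bar> \<le> 2" if "(k, l) \<in> ?K" for k l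
        using that by (auto simp: quad_freqs_def)
      have "\<bar>k0\<bar> \<le> 3" "\<bar>k1\<bar> \<le> 3" "\<bar>k2\<bar> \<le> 3" "\<bar>k3\<bar> \<le> 3"
        "\<bar>l0\<bar> \<le> 2" "\<bar>l1\<bar> \<le> 2" "\<bar>l2\<bar> \<le> 2" "\<bar>l3\<bar> \<le> 2"
        using \<open>\<kappa> \<in> ?K4\<close> small unfolding \<kappa> by auto
      \<comment> \<open>The largest of these is \<open>c\<close>, at most
        \<open>3 * (1 + 4 + 9) = 42\<close>; so for \<open>N > 50\<close> vanishing modulo
        \<open>N\<close> means vanishing.\<close>
      hence "\<bar>a\<bar> \<le> 50" "\<bar>b\<bar> \<le> 50" "\<bar>c\<bar> \<le> 50" "\<bar>u\<bar> \<le> 50" "\<bar>v\<bar> \<le> 50"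
        unfolding a_def b_def c_def u_def v_def abs_le_iff by auto
      moreover have "int N dvd z \<longleftrightarrow> z = 0" if "\<bar>z\<bar> \<le> 50" for z
        using that assms(2) dvd_imp_le_int[of z "int N"] by auto
      ultimately have "\<not> (int N dvd a \<and> int N dvd b \<and> int N dvd c \<and> int N dvd u \<and> int N dvd v)"
        using False van by simp
      thus ?thesis
        using norm_quadratic_sum2_le[of N a b c u v] assms False unfolding T_def E M_def by simp
    qed
  qed

  have "(\<Sum>\<kappa>\<in>?K4. w \<kappa> * M \<kappa>) = (\<Sum>\<kappa>\<in>{\<kappa>\<in>?K4. ap_vanishing \<kappa>}. w \<kappa>) * (real N)\<^sup>2"
    by (subst sum.inter_filter) (auto simp: M_def sum_distrib_right intro!: sum.cong)
  \<comment> \<open>The constant quadruple gives \<open>(1/2)^4\<close>; each of the other four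
    contains exactly one negative coefficient and gives \<open>-(1/16)^4\<close>.\<close>
  also have "(\<Sum>\<kappa>\<in>{\<kappa>\<in>?K4. ap_vanishing \<kappa>}. w \<kappa>) = 1 / 16 - 4 / 65536"
    unfolding ap_vanishing_quad_freqs by (simp add: w_def quad_coeff_def)
  finally have main: "(\<Sum>\<kappa>\<in>?K4. w \<kappa> * M \<kappa>) = (real N)\<^sup>2 * (1 / 16 - 4 / 65536)"
    by (simp add: mult.commute)
  have "(\<Sum>\<kappa>\<in>?K4. \<bar>w \<kappa>\<bar>) = (\<Sum>(p, q, r, s)\<in>?K4. \<bar>quad_coeff p\<bar> * \<bar>quad_coeff q\<bar> * \<bar>quad_coeff r\<bar> * \<bar>quad_coeff s\<bar>)"
    by (intro sum.cong) (auto simp: w_def abs_mult)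
  also have "\<dots> = 1"
    unfolding sum_mult4[symmetric] by (simp add: sum_abs_quad_coeff)
  finally have w1: "(\<Sum>\<kappa>\<in>?K4. \<bar>w \<kappa>\<bar>) = 1" .

  have "\<bar>S - (\<Sum>\<kappa>\<in>?K4. w \<kappa> * M \<kappa>)\<bar> = cmod (complex_of_real (S - (\<Sum>\<kappa>\<in>?K4. w \<kappa> * M \<kappa>)))"
    by (simp only: norm_of_real)
  also have "complex_of_real (S - (\<Sum>\<kappa>\<in>?K4. w \<kappa> * M \<kappa>)) =
      (\<Sum>\<kappa>\<in>?K4. of_real (w \<kappa>) * (T \<kappa> - of_real (M \<kappa>)))"
    by (simp add: S right_diff_distrib sum_subtractf)
  also have "cmod \<dots> \<le> (\<Sum>\<kappa>\<in>?K4. \<bar>w \<kappa>\<bar> * (real N * sqrt (real N)))"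
    using T by (intro sum_norm_le) (auto simp: norm_mult intro!: mult_left_mono)
  also have "\<dots> = real N * sqrt (real N)"
    unfolding sum_distrib_right[symmetric] w1 by simp
  finally show ?thesis unfolding main S_def .
qed

subsection \<open>The uniform set\<close>

lemma ap4_distinct_mod:
  assumes "prime N" "N > 3" "\<not> int N dvd d"
  shows "distinct [x mod int N, (x + d) mod int N, (x + 2 * d) mod int N, (x + 3 * d) mod int N]"
proof -
  have neq: "(x + i * d) mod int N \<noteq> (x + j * d) mod int N"
    if "i \<in> {0..3}" "j \<in> {0..3}" "i \<noteq> j" for i j
  proof
    assume "(x + i * d) mod int N = (x + j * d) mod int N"
    hence "int N dvd (i - j) * d" by (simp add: mod_eq_dvd_iff algebra_simps)
    hence "int N dvd i - j" using assms by (simp add: prime_dvd_mult_iff)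
    thus False using that assms(2) dvd_imp_le_int[of "i - j" "int N"] by auto
  qed
  show ?thesis
    using neq[of 0 1] neq[of 0 2] neq[of 0 3] neq[of 1 2] neq[of 1 3] neq[of 2 3] by simp
qed

text \<open>The degenerate progressions \<open>d = 0\<close> are counted linearly, which makes the functional
  multiaffine without changing its value on indicator functions.\<close>

definition ap4_multiaffine :: "nat \<Rightarrow> (int \<Rightarrow> real) \<Rightarrow> real" where
  "ap4_multiaffine N a = inverse ((real N)\<^sup>2) *
     (\<Sum>x\<in>Zmod N. a x + (\<Sum>d\<in>Zmod N - {0}. a (x mod int N) * a ((x + d) mod int N)
        * a ((x + 2 * d) mod int N) * a ((x + 3 * d) mod int N)))"

lemma multiaffine_ap4_multiaffine:
  assumes "prime N" "N > 3"
  shows "multiaffine X (ap4_multiaffine N)"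
proof -
  have "\<not> int N dvd d" if "d \<in> Zmod N - {0}" for d
    using that by (auto simp: Zmod_def dest: zdvd_imp_le)
  thus ?thesis
    unfolding ap4_multiaffine_def[abs_def] using assms
    by (intro multiaffine_cmult multiaffine_sum multiaffine_add multiaffine_apply
        multiaffine_mult4 ap4_distinct_mod) auto
qed

lemma ap4_multiaffine_indicator:
  assumes "N > 0" and h: "\<And>x. x \<in> Zmod N \<Longrightarrow> h x = indicator A x"
  shows "ap4_multiaffine N h = ap4_density N A"
proof -
  have Z: "Zmod N = insert 0 (Zmod N - {0})" using assms(1) by (auto simp: Zmod_def)
  have mod: "x mod int N = x" if "x \<in> Zmod N" for x
    using that by (simp add: Zmod_def)
  have "(\<Sum>d\<in>Zmod N. indicator A x * indicator A ((x + d) mod int N)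
      * indicator A ((x + 2 * d) mod int N) * indicator A ((x + 3 * d) mod int N)) =
      h x + (\<Sum>d\<in>Zmod N - {0}. h (x mod int N) * h ((x + d) mod int N)
        * h ((x + 2 * d) mod int N) * h ((x + 3 * d) mod int N))" if "x \<in> Zmod N" for x
    using that assms(1)
    by (subst Z, subst sum.insert) (auto simp: h mod indicator_def)
  thus ?thesis by (simp add: ap4_multiaffine_def ap4_density_def expect2_def)
qed

text \<open>The linear diagonal costs at most \<open>1 / N\<close>, and restoring
  \<open>d = 0\<close> to the inner sum only increases it because the weight is nonnegative.\<close>

lemma ap4_multiaffine_profile:
  assumes "prime N" "N > 50"
  shows "ap4_multiaffine N (profile N) \<le> 1 / 16 - 4 / 65536 + 1 / sqrt (real N) + 1 / real N"
proof -
  let ?g = "profile N"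
  have N: "N > 0" using assms by simp
  have "(\<Sum>x\<in>Zmod N. ?g x + (\<Sum>d\<in>Zmod N - {0}. ?g (x mod int N) * ?g ((x + d) mod int N)
        * ?g ((x + 2 * d) mod int N) * ?g ((x + 3 * d) mod int N)))
    \<le> (\<Sum>x\<in>Zmod N. 1 + (\<Sum>d\<in>Zmod N. ?g x * ?g (x + d) * ?g (x + 2 * d) * ?g (x + 3 * d)))"
    unfolding profile_mod[OF N]
    by (intro sum_mono add_mono sum_mono2) (auto simp: profile_bounds)
  also have "\<dots> \<le> real N + ((real N)\<^sup>2 * (1 / 16 - 4 / 65536) + real N * sqrt (real N))"
    using profile_ap4[OF assms] by (simp add: sum.distrib)
  finally have "ap4_multiaffine N ?g \<le> inverse ((real N)\<^sup>2) *
      (real N + ((real N)\<^sup>2 * (1 / 16 - 4 / 65536) + real N * sqrt (real N)))"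
    unfolding ap4_multiaffine_def by (intro mult_left_mono) auto
  also have "\<dots> = 1 / 16 - 4 / 65536 + sqrt (real N) / real N + 1 / real N"
    using N by (simp add: field_simps power2_eq_square)
  also have "sqrt (real N) / real N = 1 / sqrt (real N)"
    using N by (simp add: field_simps)
  finally show ?thesis .
qed

text \<open>The residue \<open>r = 0\<close> is tested too: it controls the cardinality of
  \<open>A\<close>, the others its uniformity.\<close>

lemma rounded_profile:
  assumes "prime N" "N \<ge> 10 ^ 10"
  obtains A where "A \<subseteq> Zmod N" "ap4_density N A \<le> 1 / 16 - 1 / 65536"
    "\<And>r. r \<in> Zmod N \<Longrightarrow> cmod ((\<Sum>x\<in>Zmod N. indicator A x * ephase N (- (r * x)))
        - (if int N dvd r then of_nat N / 2 else 0)) \<le> 5 * sqrt (real N) * ln (real N)"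
proof -
  let ?g = "profile N" and ?Z = "Zmod N"
  let ?I = "?Z \<times> {..<4::nat}"
  have N: "N > 0" "N > 3" "N > 50" using assms by auto
  \<comment> \<open>This scale gives \<open>s\<^sup>2 * N = 1\<close>, so every moment at the weight
    is at most \<open>exp 1\<close>.\<close>
  define s where "s = 1 / sqrt (real N)"
  have "sqrt (real N) \<ge> sqrt ((10 ^ 5)\<^sup>2)"
    using assms(2) by (intro real_sqrt_le_mono) auto
  hence sqrtN: "sqrt (real N) \<ge> 10 ^ 5" by simp
  have s: "0 < s" "s \<le> 1 / 10 ^ 5"
    using sqrtN N by (auto simp: s_def field_simps)
  have s2: "s\<^sup>2 = 1 / real N" using N by (simp add: s_def power_divide)
  have s2_le: "s\<^sup>2 \<le> s / 10 ^ 5" using s by (simp add: power2_eq_square)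
  \<comment> \<open>Upper bounds for the real parts of the four rotations by powers of
    \<open>\<i>\<close> bound the real and imaginary parts from both sides.\<close>
  define t where "t = (\<lambda>(r, j::nat) x. Re (\<i> ^ j * ephase N (- (r * x))))"
  have t: "\<bar>t i x\<bar> \<le> 1" for i x
    using abs_Re_le_cmod[of "\<i> ^ snd i * ephase N (- (fst i * x))"]
    by (auto simp: t_def norm_mult norm_power split: prod.splits)
  obtain A h where A: "A \<subseteq> ?Z" and h: "\<And>x. x \<in> ?Z \<Longrightarrow> h x = indicator A x"
    and le: "ap4_multiaffine N h +
         1 / (real N)\<^sup>2 * (\<Sum>i\<in>?I. exp (s * (\<Sum>x\<in>?Z. (indicator A x - ?g x) * t i x)))
       \<le> ap4_multiaffine N ?g + 1 / (real N)\<^sup>2 * (real (card ?I) * exp (s\<^sup>2 * real (card ?Z)))"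
  proof (rule rounding_with_tests[of ?Z "ap4_multiaffine N" ?g ?I t s "1 / (real N)\<^sup>2"])
    show "multiaffine ?Z (ap4_multiaffine N)"
      using assms N by (intro multiaffine_ap4_multiaffine)
    show "0 \<le> ?g x \<and> ?g x \<le> 1" for x by (simp add: profile_bounds)
    show "\<bar>t i x\<bar> \<le> 1" for i x by (rule t)
    show "0 \<le> s" "s \<le> 1" using s by auto
    show "finite ?Z" "0 \<le> 1 / (real N)\<^sup>2" by auto
  qed (rule that)
  define F where "F = (\<lambda>i. exp (s * (\<Sum>x\<in>?Z. (indicator A x - ?g x) * t i x)))"
  have hA: "ap4_multiaffine N h = ap4_density N A"
    using N(1) h by (rule ap4_multiaffine_indicator)
  have "1 / (real N)\<^sup>2 * (real (card ?I) * exp (s\<^sup>2 * real (card ?Z))) = 4 * exp 1 / real N"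
    unfolding s2 using N by (simp add: card_cartesian_product field_simps power2_eq_square)
  also have "\<dots> \<le> 12 * s\<^sup>2"
    using N exp_le by (simp add: s2 divide_right_mono)
  finally have "ap4_density N A + 1 / (real N)\<^sup>2 * (\<Sum>i\<in>?I. F i)
      \<le> 1 / 16 - 4 / 65536 + s + s\<^sup>2 + 12 * s\<^sup>2"
    using le[folded F_def] ap4_multiaffine_profile[OF assms(1) N(3)]
    unfolding hA s2[symmetric] s_def[symmetric] by linarith
  \<comment> \<open>Here \<open>s + 13 * s\<^sup>2\<close> must fit into 3/65536, about
    \<open>4.6 / 10^5\<close>; \<open>N \<ge> 10 ^ 10\<close> ensures this through
    \<open>s \<le> 1 / 10 ^ 5\<close>.\<close>
  also have "\<dots> \<le> 1 / 16 - 1 / 65536"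
    using s s2_le by simp
  finally have bound: "ap4_density N A + 1 / (real N)\<^sup>2 * (\<Sum>i\<in>?I. F i) \<le> 1 / 16 - 1 / 65536" .
  have F0: "0 \<le> F i" for i by (simp add: F_def)
  have d0: "0 \<le> ap4_density N A"
    unfolding ap4_density_def expect2_def by (intro mult_nonneg_nonneg sum_nonneg) auto
  have test: "Re (\<i> ^ j * (\<Sum>x\<in>?Z. of_real (indicator A x - ?g x) * ephase N (- (r * x))))
      \<le> 2 * sqrt (real N) * ln (real N)" if "r \<in> ?Z" "j < 4" for r j
  proof -
    \<comment> \<open>All moments and the density are nonnegative, so the joint bound limits each
      single moment to \<open>N\<^sup>2\<close>; taking logarithms bounds the tested error.\<close>
    have "F (r, j) \<le> (\<Sum>i\<in>?I. F i)"
      using that F0 by (intro member_le_sum) auto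
    also have "\<dots> \<le> (real N)\<^sup>2"
    proof -
      have "1 / (real N)\<^sup>2 * (\<Sum>i\<in>?I. F i) \<le> 1" using bound d0 by linarith
      thus ?thesis using N by (simp add: divide_le_eq)
    qed
    finally have "exp (s * (\<Sum>x\<in>?Z. (indicator A x - ?g x) * t (r, j) x)) \<le> (real N)\<^sup>2"
      by (simp add: F_def)
    hence "s * (\<Sum>x\<in>?Z. (indicator A x - ?g x) * t (r, j) x) \<le> ln ((real N)\<^sup>2)"
      using N by (subst ln_ge_iff) auto
    also have "\<dots> = 2 * ln (real N)" using N by (simp add: ln_realpow)
    finally have "(\<Sum>x\<in>?Z. (indicator A x - ?g x) * t (r, j) x) \<le> 2 * sqrt (real N) * ln (real N)"
      using N by (simp add: s_def field_simps)
    moreover have "Re (\<i> ^ j * (\<Sum>x\<in>?Z. of_real (indicator A x - ?g x) * ephase N (- (r * x))))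
        = (\<Sum>x\<in>?Z. (indicator A x - ?g x) * t (r, j) x)"
      unfolding t_def sum_distrib_left Re_sum prod.case
      by (intro sum.cong refl) (simp add: mult.left_commute[of "\<i> ^ j"] del: Re_i_times of_real_diff)
    ultimately show ?thesis by simp
  qed
  have ln1: "1 \<le> ln (real N)"
    using exp_le N by (subst ln_ge_iff) auto
  have "cmod ((\<Sum>x\<in>?Z. indicator A x * ephase N (- (r * x)))
        - (if int N dvd r then of_nat N / 2 else 0)) \<le> 5 * sqrt (real N) * ln (real N)"
    if r: "r \<in> ?Z" for r
  proof -
    define S where "S = (\<Sum>x\<in>?Z. complex_of_real (indicator A x - ?g x) * ephase N (- (r * x)))"
    define P where "P = (\<Sum>x\<in>?Z. complex_of_real (?g x) * ephase N (- (r * x)))"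
    have "Re S \<le> 2 * sqrt (real N) * ln (real N)" "- Im S \<le> 2 * sqrt (real N) * ln (real N)"
      "- Re S \<le> 2 * sqrt (real N) * ln (real N)" "Im S \<le> 2 * sqrt (real N) * ln (real N)"
      using test[OF r, of 0] test[OF r, of 1] test[OF r, of 2] test[OF r, of 3]
      unfolding S_def[symmetric] by (simp_all add: power3_eq_cube)
    \<comment> \<open>Real and imaginary part contribute 2 each; the coefficient of the weight
      itself raises the constant from 4 to 5.\<close>
    hence "cmod S \<le> 4 * sqrt (real N) * ln (real N)"
      using cmod_le[of S] by linarith
    moreover have "cmod (P - (if int N dvd r then of_nat N / 2 else 0)) \<le> sqrt (real N) / 2"
      unfolding P_def using assms(1) N(2) by (rule profile_fourier)
    moreover have "sqrt (real N) / 2 \<le> sqrt (real N) * ln (real N)"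
      using ln1 mult_left_mono[of "1/2" "ln (real N)" "sqrt (real N)"] by simp
    moreover have "(\<Sum>x\<in>?Z. indicator A x * ephase N (- (r * x))) = S + P"
      unfolding S_def P_def sum.distrib[symmetric]
      by (intro sum.cong refl) (simp add: indicator_def algebra_simps)
    ultimately show ?thesis
      using norm_triangle_ineq[of S "P - (if int N dvd r then of_nat N / 2 else 0)"]
      by (simp add: add_diff_eq)
  qed
  moreover have "ap4_density N A \<le> 1 / 16 - 1 / 65536"
  proof -
    have "0 \<le> 1 / (real N)\<^sup>2 * (\<Sum>i\<in>?I. F i)"
      using F0 by (intro mult_nonneg_nonneg sum_nonneg) auto
    thus ?thesis using bound by linarith
  qed
  ultimately show ?thesis using A that by blast
qed

theorem theorem6:
  "\<exists>(c::real) (C::real) (\<epsilon>::nat \<Rightarrow> real).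
     c > 0 \<and> \<epsilon> \<longlonglongrightarrow> 0 \<and>
     (\<exists>N0::nat. \<forall>N\<ge>N0. prime N \<longrightarrow>
       (\<exists>A. A \<subseteq> Zmod N \<and>
            \<bar>real (card A) / real N - 1 / 2\<bar> \<le> \<epsilon> N \<and>
            uniform_set N (C * real N powr (- 1 / 2) * ln (real N)) A \<and>
            ap4_density N A \<le> 1 / 2 ^ 4 - c))"
proof -
  \<comment> \<open>One function serves as density error and uniformity bound, since both are the
    Fourier bound divided by \<open>N\<close>.\<close>
  define \<epsilon> where "\<epsilon> = (\<lambda>N::nat. 5 * real N powr (- 1 / 2) * ln (real N))"
  have \<epsilon>_eq: "\<epsilon> N = 5 * (ln (real N) / sqrt (real N))" for N
    by (simp add: \<epsilon>_def powr_minus_divide powr_half_sqrt)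
  \<comment> \<open>With \<open>y = sqrt N\<close>, \<open>ln N = 2 * ln y\<close> reduces the limit
    to \<open>ln y / y\<close> tending to 0; hence the factor 10.\<close>
  have "(\<lambda>N. 10 * (ln (sqrt (real N)) / sqrt (real N))) \<longlonglongrightarrow> 10 * 0"
    by (intro tendsto_mult tendsto_const filterlim_compose[OF ln_x_over_x_tendsto_0]
        filterlim_compose[OF sqrt_at_top] filterlim_real_sequentially)
  moreover have "\<forall>\<^sub>F N in sequentially. 10 * (ln (sqrt (real N)) / sqrt (real N)) = \<epsilon> N"
    using eventually_gt_at_top[of "0::nat"] by eventually_elim (simp add: \<epsilon>_eq ln_sqrt)
  ultimately have \<epsilon>: "\<epsilon> \<longlonglongrightarrow> 0"
    using Lim_transform_eventually by fastforce
  have "\<exists>A. A \<subseteq> Zmod N \<and> \<bar>real (card A) / real N - 1 / 2\<bar> \<le> \<epsilon> N \<and>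
            uniform_set N (5 * real N powr (- 1 / 2) * ln (real N)) A \<and>
            ap4_density N A \<le> 1 / 2 ^ 4 - 1 / 65536"
    if N: "prime N" "N \<ge> 10 ^ 10" for N
  proof -
    obtain A where A: "A \<subseteq> Zmod N" "ap4_density N A \<le> 1 / 16 - 1 / 65536"
      and F: "\<And>r. r \<in> Zmod N \<Longrightarrow> cmod ((\<Sum>x\<in>Zmod N. indicator A x * ephase N (- (r * x)))
        - (if int N dvd r then of_nat N / 2 else 0)) \<le> 5 * sqrt (real N) * ln (real N)"
      by (rule rounded_profile[OF N]) (rule that)
    have pos: "N > 0" using N by simp
    have \<epsilon>N: "\<epsilon> N = 5 * sqrt (real N) * ln (real N) / real N"
      unfolding \<epsilon>_eq using pos by (simp add: field_simps)
    have "\<bar>real (card A) / real N - 1 / 2\<bar> \<le> \<epsilon> N"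
    proof -
      have "(\<Sum>x\<in>Zmod N. indicator A x) = complex_of_nat (card A)"
        using A(1) by (simp add: indicator_def of_bool_def sum.If_cases Int_absorb1)
      hence "cmod (of_real (real (card A) - real N / 2)) \<le> 5 * sqrt (real N) * ln (real N)"
        using F[of 0] pos by (simp add: Zmod_def)
      hence "\<bar>real (card A) - real N / 2\<bar> / real N \<le> \<epsilon> N"
        unfolding \<epsilon>N norm_of_real using pos by (intro divide_right_mono) auto
      also have "\<bar>real (card A) - real N / 2\<bar> / real N = \<bar>(real (card A) - real N / 2) / real N\<bar>"
        by simp
      also have "(real (card A) - real N / 2) / real N = real (card A) / real N - 1 / 2"
        using pos by (simp add: field_simps)
      finally show ?thesis .
    qed
    moreover have "uniform_set N (\<epsilon> N) A"
      unfolding uniform_set_def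
    proof (intro conjI ballI impI A(1))
      fix r assume r: "r \<in> Zmod N" "r \<noteq> 0"
      hence "\<not> int N dvd r" by (auto simp: Zmod_def dest: zdvd_imp_le)
      hence "cmod (\<Sum>x\<in>Zmod N. indicator A x * ephase N (- (r * x))) / real N \<le> \<epsilon> N"
        unfolding \<epsilon>N using F[OF r(1)] by (intro divide_right_mono) auto
      thus "cmod (fourier N (indicator A) r) \<le> \<epsilon> N"
        by (simp add: fourier_def expect_def omega_powi norm_mult norm_inverse divide_inverse
            mult.commute)
    qed
    ultimately show ?thesis using A by (auto simp: \<epsilon>_def)
  qed
  hence large: "\<exists>N0. \<forall>N\<ge>N0. prime N \<longrightarrow>
      (\<exists>A. A \<subseteq> Zmod N \<and> \<bar>real (card A) / real N - 1 / 2\<bar> \<le> \<epsilon> N \<and>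
            uniform_set N (5 * real N powr (- 1 / 2) * ln (real N)) A \<and>
            ap4_density N A \<le> 1 / 2 ^ 4 - 1 / 65536)"
    by blast
  show ?thesis
    by (rule exI[of _ "1 / 65536"], rule exI[of _ 5], rule exI[of _ \<epsilon>], intro conjI \<epsilon> large) simp
qed

end
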